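(* Let $\beta>0$, $B\in\mathbb R$ and $\alpha_0>4\beta^2$. Suppose the pattern entries $\xi^k_i$ are independent Bernoulli variables, $\mathbb P[\xi^k_i=1]=\mathbb P[\xi^k_i=-1]=\tfrac12$. Then for some $c>0$, $\mathbb E\big[\langle e^{cS^2}\rangle\big]<\infty$ uniformly in $N$ and $\alpha\ge\alpha_0$; that is, there exist $c>0$ and $K<\infty$ such that $\mathbb E\big[\langle e^{cS^2}\rangle\big]\le K$ for all integers $N,M\ge1$ with $\alpha=M/N\ge\alpha_0$.
   Context: Configurations are $x\in\{\pm1\}^N$. Patterns are random vectors $\xi^k=(\xi^k_1,\dots,\xi^k_N)\in\mathbb R^N$, $1\le k\le M$. The Hopfield Hamiltonian (with the normalisation used here) is $$H(x)=H^{Hop}_{N,M}(x;\xi)=-\frac1{\sqrt{NM}}\sum_{k=1}^M\big(x\cdot\xi^k\big)^2.$$ The Gibbs measure with inverse temperature $\beta$ and external field $B$ is the (random) probability measure on $\{\pm1\}^N$ given by $G(x)=Z(\beta,B)^{-1}e^{-\beta H(x)+B\sum_ix_i}$, where $Z(\beta,B)=\sum_{x}e^{-\beta H(x)+B\sum_ix_i}$. $\langle\cdot\rangle$ denotes expectation over $x$ with respect to $G$ for fixed patterns, and $\mathbb E$ denotes expectation over the patterns. The overlap is $S=(x\cdot\xi^1)/\sqrt N$. *)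

theory Defs
  imports "HOL-Probability.Probability"
begin

text \<open>Sites are \<open>1, \<dots>, N\<close> and patterns \<open>1, \<dots>, M\<close>. Configurations are extensional
  functions, so that there are exactly \<open>2 ^ N\<close> of them.\<close>

definition configs :: "nat \<Rightarrow> (nat \<Rightarrow> real) set" where
  "configs N = {1..N} \<rightarrow>\<^sub>E {-1, 1}"

definition dotp :: "nat \<Rightarrow> (nat \<Rightarrow> real) \<Rightarrow> (nat \<Rightarrow> real) \<Rightarrow> real" where
  "dotp N x y = (\<Sum>i = 1..N. x i * y i)"

definition hopfield_H :: "nat \<Rightarrow> nat \<Rightarrow> (nat \<Rightarrow> nat \<Rightarrow> real) \<Rightarrow> (nat \<Rightarrow> real) \<Rightarrow> real" where
  "hopfield_H N M \<xi> x = - (1 / sqrt (real N * real M)) * (\<Sum>k = 1..M. (dotp N x (\<xi> k))\<^sup>2)"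

definition boltzmann_weight ::
  "real \<Rightarrow> real \<Rightarrow> nat \<Rightarrow> nat \<Rightarrow> (nat \<Rightarrow> nat \<Rightarrow> real) \<Rightarrow> (nat \<Rightarrow> real) \<Rightarrow> real" where
  "boltzmann_weight \<beta> B N M \<xi> x = exp (- \<beta> * hopfield_H N M \<xi> x + B * (\<Sum>i = 1..N. x i))"

definition partition_fun :: "real \<Rightarrow> real \<Rightarrow> nat \<Rightarrow> nat \<Rightarrow> (nat \<Rightarrow> nat \<Rightarrow> real) \<Rightarrow> real" where
  "partition_fun \<beta> B N M \<xi> = (\<Sum>x\<in>configs N. boltzmann_weight \<beta> B N M \<xi> x)"

definition gibbs ::
  "real \<Rightarrow> real \<Rightarrow> nat \<Rightarrow> nat \<Rightarrow> (nat \<Rightarrow> nat \<Rightarrow> real) \<Rightarrow> (nat \<Rightarrow> real) measure" where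
  "gibbs \<beta> B N M \<xi> = point_measure (configs N)
     (\<lambda>x. ennreal (boltzmann_weight \<beta> B N M \<xi> x / partition_fun \<beta> B N M \<xi>))"

definition overlap :: "nat \<Rightarrow> (nat \<Rightarrow> nat \<Rightarrow> real) \<Rightarrow> (nat \<Rightarrow> real) \<Rightarrow> real" where
  "overlap N \<xi> x = dotp N x (\<xi> 1) / sqrt (real N)"

definition bernoulli_patterns ::
  "'w measure \<Rightarrow> nat \<Rightarrow> nat \<Rightarrow> (nat \<Rightarrow> nat \<Rightarrow> 'w \<Rightarrow> real) \<Rightarrow> bool" where
  "bernoulli_patterns P N M \<xi> \<longleftrightarrow>
     prob_space P \<and>
     prob_space.indep_vars P (\<lambda>_. borel) (\<lambda>(k, i). \<xi> k i) ({1..M} \<times> {1..N}) \<and>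
     (\<forall>k\<in>{1..M}. \<forall>i\<in>{1..N}.
        measure P {\<omega> \<in> space P. \<xi> k i \<omega> = 1} = 1 / 2 \<and>
        measure P {\<omega> \<in> space P. \<xi> k i \<omega> = - 1} = 1 / 2)"

lemma finite_configs: "finite (configs N)"
  unfolding configs_def by (intro finite_PiE) auto

lemma configs_nonempty: "configs N \<noteq> {}"
  unfolding configs_def by (simp add: PiE_eq_empty_iff)

lemma partition_fun_pos: "partition_fun \<beta> B N M \<xi> > 0"
  unfolding partition_fun_def boltzmann_weight_def
  by (intro sum_pos finite_configs configs_nonempty) auto

lemma prob_space_gibbs: "prob_space (gibbs \<beta> B N M \<xi>)"
proof -
  let ?Z = "partition_fun \<beta> B N M \<xi>"
  have nn: "0 \<le> boltzmann_weight \<beta> B N M \<xi> x / ?Z" for x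
    using partition_fun_pos[of \<beta> B N M \<xi>] by (simp add: boltzmann_weight_def)
  have "(\<Sum>x\<in>configs N. boltzmann_weight \<beta> B N M \<xi> x / ?Z) = 1"
    using partition_fun_pos[of \<beta> B N M \<xi>]
    by (simp add: sum_divide_distrib[symmetric] partition_fun_def)
  then show ?thesis
    unfolding gibbs_def using nn
    by (intro prob_space_point_measure finite_configs) (auto simp: sum_ennreal)
qed

lemma integral_gibbs:
  fixes f :: "(nat \<Rightarrow> real) \<Rightarrow> real"
  shows "(\<integral>x. f x \<partial>gibbs \<beta> B N M \<xi>) =
    (\<Sum>x\<in>configs N. boltzmann_weight \<beta> B N M \<xi> x * f x) / partition_fun \<beta> B N M \<xi>"
proof -
  have nn: "0 \<le> boltzmann_weight \<beta> B N M \<xi> x / partition_fun \<beta> B N M \<xi>" for x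
    using partition_fun_pos[of \<beta> B N M \<xi>] by (simp add: boltzmann_weight_def)
  show ?thesis
    unfolding gibbs_def using nn
    by (simp add: lebesgue_integral_point_measure_finite finite_configs sum_divide_distrib)
qed

end

theory Submission
  imports Defs
begin

text \<open>Write the Boltzmann weight as \<open>exp (b S\<^sup>2)\<close>, with \<open>b = \<beta> sqrt (N / M)\<close>, times a
  weight that does not involve \<open>\<xi> 1\<close>. Since \<open>exp (b S\<^sup>2) \<ge> 1\<close>, dropping this factor decreases
  the partition function, so the Gibbs average of \<open>exp (c S\<^sup>2)\<close> is at most the average of
  \<open>exp ((b + c) S\<^sup>2)\<close> under the cavity measure, which is independent of \<open>\<xi> 1\<close>. For every
  fixed configuration \<open>S\<close> is subgaussian with variance proxy 1, so the expectation over
  \<open>\<xi> 1\<close> is at most \<open>1 / sqrt (1 - 2 (b + c))\<close>, and \<open>b \<le> \<beta> / sqrt \<alpha>\<^sub>0 < 1 / 2\<close>.\<close>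

section \<open>Gaussian integrals\<close>

lemma nn_integral_normal_density:
  assumes "\<sigma> > 0"
  shows "(\<integral>\<^sup>+ g. ennreal (normal_density \<mu> \<sigma> g) \<partial>lborel) = 1"
  using assms by (subst nn_integral_eq_integral) auto

text \<open>Completing the square: tilting the standard normal density by \<open>exp (a * g)\<close>
  moves its mean to \<open>a\<close> and leaves the factor \<open>exp (a^2 / 2)\<close>.\<close>

lemma nn_integral_std_normal_exp_linear:
  "(\<integral>\<^sup>+ g. ennreal (std_normal_density g * exp (a * g)) \<partial>lborel) = ennreal (exp (a\<^sup>2 / 2))"
proof -
  have "std_normal_density g * exp (a * g) = exp (a\<^sup>2 / 2) * normal_density a 1 g" for g
    by (simp add: normal_density_def exp_add[symmetric] power2_eq_square field_simps)
  then show ?thesis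
    by (simp add: ennreal_mult nn_integral_cmult nn_integral_normal_density)
qed

text \<open>The tilt by \<open>exp (t * g^2)\<close> gives a centered Gaussian of variance
  \<open>1 / (1 - 2 * t)\<close>, which is positive exactly for \<open>t < 1 / 2\<close>. The ratio
  of the two normalising constants is its standard deviation.\<close>

lemma nn_integral_std_normal_exp_square:
  assumes "t < 1 / 2"
  shows "(\<integral>\<^sup>+ g. ennreal (std_normal_density g * exp (t * g\<^sup>2)) \<partial>lborel) = ennreal (1 / sqrt (1 - 2 * t))"
proof -
  define \<sigma> where "\<sigma> = 1 / sqrt (1 - 2 * t)"
  have pos: "1 - 2 * t > 0" using assms by simp
  have \<sigma>: "\<sigma> > 0" "\<sigma>\<^sup>2 = 1 / (1 - 2 * t)"
    using pos by (auto simp: \<sigma>_def power_divide)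
  have "std_normal_density g * exp (t * g\<^sup>2) = \<sigma> * normal_density 0 \<sigma> g" for g
  proof -
    have "- (g\<^sup>2) / 2 + t * g\<^sup>2 = - (g\<^sup>2) / (2 * \<sigma>\<^sup>2)"
      unfolding \<sigma>(2) by (simp add: field_simps)
    moreover have "sqrt (2 * pi * \<sigma>\<^sup>2) = \<sigma> * sqrt (2 * pi)"
      using \<sigma>(1) by (simp add: real_sqrt_mult)
    ultimately show ?thesis
      using \<sigma>(1) by (simp add: normal_density_def exp_add[symmetric])
  qed
  then show ?thesis
    using \<sigma>(1) by (simp add: ennreal_mult nn_integral_cmult nn_integral_normal_density flip: \<sigma>_def)
qed

section \<open>Subgaussian estimates and fair signs\<close>

context prob_space
begin

text \<open>Gaussian linearisation: \<open>exp (t Y\<^sup>2)\<close> is the average of \<open>exp (sqrt (2 t) g Y)\<close> over a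
  standard normal variable \<open>g\<close>.\<close>
lemma nn_integral_exp_square_le:
  assumes Y [measurable]: "random_variable borel Y"
    and mgf: "\<And>s. (\<integral>\<^sup>+ \<omega>. ennreal (exp (s * Y \<omega>)) \<partial>M) \<le> ennreal (exp (s\<^sup>2 / 2))"
    and t: "0 \<le> t" "t < 1 / 2"
  shows "(\<integral>\<^sup>+ \<omega>. ennreal (exp (t * (Y \<omega>)\<^sup>2)) \<partial>M) \<le> ennreal (1 / sqrt (1 - 2 * t))"
proof -
  interpret pair_sigma_finite M lborel ..
  let ?r = "sqrt (2 * t)"
  have "(\<integral>\<^sup>+ \<omega>. ennreal (exp (t * (Y \<omega>)\<^sup>2)) \<partial>M)
      = (\<integral>\<^sup>+ \<omega>. \<integral>\<^sup>+ g. ennreal (std_normal_density g * exp ((?r * Y \<omega>) * g)) \<partial>lborel \<partial>M)"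
    using t by (simp only: nn_integral_std_normal_exp_linear) (simp add: power_mult_distrib)
  also have "\<dots> = (\<integral>\<^sup>+ g. \<integral>\<^sup>+ \<omega>. ennreal (std_normal_density g * exp ((?r * Y \<omega>) * g)) \<partial>M \<partial>lborel)"
    by (rule Fubini'[symmetric]) measurable
  also have "\<dots> = (\<integral>\<^sup>+ g. ennreal (std_normal_density g) * (\<integral>\<^sup>+ \<omega>. ennreal (exp ((?r * g) * Y \<omega>)) \<partial>M) \<partial>lborel)"
    by (simp add: ennreal_mult nn_integral_cmult mult_ac)
  \<comment> \<open>For each fixed \<open>g\<close> the hypothesis applies with
    \<open>s = sqrt (2 * t) * g\<close>. It returns \<open>exp (t * g^2)\<close>, so the quadratic
    exponential now sits on the Gaussian variable, where it is computed exactly.\<close>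
  also have "\<dots> \<le> (\<integral>\<^sup>+ g. ennreal (std_normal_density g) * ennreal (exp ((?r * g)\<^sup>2 / 2)) \<partial>lborel)"
    by (intro nn_integral_mono mult_left_mono mgf) auto
  also have "\<dots> = (\<integral>\<^sup>+ g. ennreal (std_normal_density g * exp (t * g\<^sup>2)) \<partial>lborel)"
    using t by (simp add: ennreal_mult power_mult_distrib)
  also have "\<dots> = ennreal (1 / sqrt (1 - 2 * t))"
    using t by (intro nn_integral_std_normal_exp_square) auto
  finally show ?thesis .
qed

text \<open>Independence turns the exponential moment into a product, and Hoeffding's lemma bounds
  each factor.\<close>

lemma nn_integral_exp_sum_le:
  assumes I: "finite I" "indep_vars (\<lambda>_. borel) X I"
    and bounded: "\<And>i. i \<in> I \<Longrightarrow> AE \<omega> in M. \<bar>X i \<omega>\<bar> \<le> (1 :: real)"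
    and centered: "\<And>i. i \<in> I \<Longrightarrow> expectation (X i) = 0"
  shows "(\<integral>\<^sup>+ \<omega>. ennreal (exp (\<Sum>i\<in>I. a i * X i \<omega>)) \<partial>M) \<le> ennreal (exp ((\<Sum>i\<in>I. (a i)\<^sup>2) / 2))"
proof -
  have rv: "random_variable borel (X i)" if "i \<in> I" for i
    using I(2) that by (auto simp: indep_vars_def)
  have ind: "indep_vars (\<lambda>_. borel) (\<lambda>i \<omega>. ennreal (exp (a i * X i \<omega>))) I"
    by (rule indep_vars_compose2[OF I(2)]) measurable
  have "(\<integral>\<^sup>+ \<omega>. ennreal (exp (\<Sum>i\<in>I. a i * X i \<omega>)) \<partial>M)
      = (\<integral>\<^sup>+ \<omega>. (\<Prod>i\<in>I. ennreal (exp (a i * X i \<omega>))) \<partial>M)"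
    by (simp add: exp_sum I prod_ennreal)
  also have "\<dots> = (\<Prod>i\<in>I. \<integral>\<^sup>+ \<omega>. ennreal (exp (a i * X i \<omega>)) \<partial>M)"
    using ind I(1) by (intro indep_vars_nn_integral) auto
  also have "\<dots> \<le> (\<Prod>i\<in>I. ennreal (exp ((a i)\<^sup>2 / 2)))"
  proof (rule prod_mono_ennreal)
    fix i assume i: "i \<in> I"
    have "AE \<omega> in M. a i * X i \<omega> \<in> {- \<bar>a i\<bar>..\<bar>a i\<bar>}"
      using bounded[OF i]
    proof eventually_elim
      case (elim \<omega>)
      then have "\<bar>a i * X i \<omega>\<bar> \<le> \<bar>a i\<bar>"
        by (simp add: abs_mult mult_left_le)
      then show ?case by auto
    qed
    \<comment> \<open>The coefficient is absorbed into the variable, so Hoeffding's lemma is used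
      with parameter 1. The interval has width \<open>2 * \<bar>a i\<bar>\<close>, hence the
      exponent \<open>(2 * \<bar>a i\<bar>)^2 / 8 = (a i)^2 / 2\<close>.\<close>
    then interpret Y: interval_bounded_random_variable M "\<lambda>\<omega>. a i * X i \<omega>" "- \<bar>a i\<bar>" "\<bar>a i\<bar>"
      using rv[OF i] by unfold_locales auto
    show "(\<integral>\<^sup>+ \<omega>. ennreal (exp (a i * X i \<omega>)) \<partial>M) \<le> ennreal (exp ((a i)\<^sup>2 / 2))"
      using Y.Hoeffdings_lemma_nn_integral_0[of 1] centered[OF i]
      by (simp add: power_mult_distrib)
  qed
  also have "\<dots> = ennreal (exp ((\<Sum>i\<in>I. (a i)\<^sup>2) / 2))"
    by (simp add: prod_ennreal exp_sum I sum_divide_distrib)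
  finally show ?thesis .
qed

text \<open>Only the probabilities of the two values are prescribed. The events are disjoint and
  their probabilities add up to 1, so together they have full measure.\<close>

lemma fair_sign_AE:
  assumes [measurable]: "random_variable borel (X :: 'a \<Rightarrow> real)"
    and "prob {\<omega> \<in> space M. X \<omega> = 1} = 1 / 2" "prob {\<omega> \<in> space M. X \<omega> = - 1} = 1 / 2"
  shows "AE \<omega> in M. X \<omega> \<in> {-1, 1}"
proof -
  have "prob ({\<omega> \<in> space M. X \<omega> = 1} \<union> {\<omega> \<in> space M. X \<omega> = - 1}) = 1"
    using assms by (subst finite_measure_Union) auto
  then have "AE \<omega> in M. \<omega> \<in> {\<omega> \<in> space M. X \<omega> = 1} \<union> {\<omega> \<in> space M. X \<omega> = - 1}"
    by (subst (asm) prob_eq_1) auto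
  then show ?thesis by eventually_elim auto
qed

lemma fair_sign_expectation:
  assumes [measurable]: "random_variable borel (X :: 'a \<Rightarrow> real)"
    and half: "prob {\<omega> \<in> space M. X \<omega> = 1} = 1 / 2" "prob {\<omega> \<in> space M. X \<omega> = - 1} = 1 / 2"
  shows "expectation X = 0"
proof -
  let ?A = "{\<omega> \<in> space M. X \<omega> = 1}" and ?B = "{\<omega> \<in> space M. X \<omega> = - 1}"
  \<comment> \<open>Almost everywhere a fair sign is the difference of the indicators of two events
    of equal probability.\<close>
  have "expectation X = expectation (\<lambda>\<omega>. indicator ?A \<omega> - indicator ?B \<omega>)"
  proof (rule integral_cong_AE)
    show "AE \<omega> in M. X \<omega> = indicator ?A \<omega> - indicator ?B \<omega>"
      using fair_sign_AE[OF assms] AE_space by eventually_elim (auto simp: indicator_def)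
  qed measurable
  also have "\<dots> = 0"
    using half by (subst Bochner_Integration.integral_diff) (auto intro!: integrable_real_indicator simp: emeasure_eq_measure)
  finally show ?thesis .
qed

end

section \<open>Cavity measure without the first pattern, and comparison with the Gibbs
  measure\<close>

definition cavity_weight ::
  "real \<Rightarrow> real \<Rightarrow> nat \<Rightarrow> nat \<Rightarrow> (nat \<Rightarrow> nat \<Rightarrow> real) \<Rightarrow> (nat \<Rightarrow> real) \<Rightarrow> real" where
  "cavity_weight \<beta> B N M \<xi> x =
     exp (\<beta> / sqrt (real N * real M) * (\<Sum>k = 2..M. (dotp N x (\<xi> k))\<^sup>2) + B * (\<Sum>i = 1..N. x i))"

definition cavity_prob ::
  "real \<Rightarrow> real \<Rightarrow> nat \<Rightarrow> nat \<Rightarrow> (nat \<Rightarrow> nat \<Rightarrow> real) \<Rightarrow> (nat \<Rightarrow> real) \<Rightarrow> real" where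
  "cavity_prob \<beta> B N M \<xi> x = cavity_weight \<beta> B N M \<xi> x / (\<Sum>y\<in>configs N. cavity_weight \<beta> B N M \<xi> y)"

lemma cavity_weight_pos: "cavity_weight \<beta> B N M \<xi> x > 0"
  by (simp add: cavity_weight_def)

lemma cavity_sum_pos: "(\<Sum>y\<in>configs N. cavity_weight \<beta> B N M \<xi> y) > 0"
  by (intro sum_pos finite_configs configs_nonempty cavity_weight_pos)

lemma cavity_prob_nonneg: "cavity_prob \<beta> B N M \<xi> x \<ge> 0"
  using cavity_sum_pos[of \<beta> B N M \<xi>] cavity_weight_pos[of \<beta> B N M \<xi> x]
  by (simp add: cavity_prob_def)

lemma sum_cavity_prob: "(\<Sum>x\<in>configs N. cavity_prob \<beta> B N M \<xi> x) = 1"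
  using cavity_sum_pos[of \<beta> B N M \<xi>] by (simp add: cavity_prob_def sum_divide_distrib[symmetric])

lemma cavity_prob_le_1:
  assumes "x \<in> configs N"
  shows "cavity_prob \<beta> B N M \<xi> x \<le> 1"
  using member_le_sum[OF assms, of "cavity_prob \<beta> B N M \<xi>"]
  by (simp add: sum_cavity_prob cavity_prob_nonneg finite_configs)

text \<open>This makes precise that the cavity measure does not see the first pattern; it is used
  below to replace the patterns by their restriction to an index block.\<close>

lemma cavity_prob_cong:
  assumes "\<And>k i. k \<in> {2..M} \<Longrightarrow> i \<in> {1..N} \<Longrightarrow> \<xi> k i = \<xi>' k i"
  shows "cavity_prob \<beta> B N M \<xi> x = cavity_prob \<beta> B N M \<xi>' x"
proof -
  have "dotp N y (\<xi> k) = dotp N y (\<xi>' k)" if "k \<in> {2..M}" for y k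
    using assms that by (simp add: dotp_def)
  then show ?thesis
    by (simp add: cavity_prob_def cavity_weight_def)
qed

text \<open>The \<open>k = 1\<close> term of the Hamiltonian is
  \<open>N * S^2 / sqrt (N * M) = sqrt (N / M) * S^2\<close>, up to sign. The factorisation is exact
  because the cavity weight keeps the normalisation \<open>sqrt (N * M)\<close> of the full
  system.\<close>

lemma boltzmann_weight_cavity:
  assumes "N \<ge> 1" "M \<ge> 1"
  shows "boltzmann_weight \<beta> B N M \<xi> x =
    exp (\<beta> * sqrt (real N / real M) * (overlap N \<xi> x)\<^sup>2) * cavity_weight \<beta> B N M \<xi> x"
proof -
  have "sqrt (real N / real M) * (overlap N \<xi> x)\<^sup>2 = (dotp N x (\<xi> 1))\<^sup>2 / sqrt (real N * real M)"
    using assms by (simp add: overlap_def power_divide real_sqrt_divide real_sqrt_mult field_simps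
        flip: power2_eq_square)
  moreover have "(\<Sum>k = 1..M. (dotp N x (\<xi> k))\<^sup>2) = (dotp N x (\<xi> 1))\<^sup>2 + (\<Sum>k = 2..M. (dotp N x (\<xi> k))\<^sup>2)"
    using assms(2) by (subst sum.atLeast_Suc_atMost) (auto simp: numeral_2_eq_2)
  ultimately show ?thesis
    by (simp add: boltzmann_weight_def hopfield_H_def cavity_weight_def exp_add[symmetric]
        mult.assoc algebra_simps add_divide_distrib)
qed

text \<open>The first pattern only increases the partition function.\<close>
lemma gibbs_integral_le_cavity:
  assumes "\<beta> \<ge> 0" "N \<ge> 1" "M \<ge> 1"
  shows "(\<integral>x. exp (c * (overlap N \<xi> x)\<^sup>2) \<partial>gibbs \<beta> B N M \<xi>) \<le>
    (\<Sum>x\<in>configs N. cavity_prob \<beta> B N M \<xi> x *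
       exp ((\<beta> * sqrt (real N / real M) + c) * (overlap N \<xi> x)\<^sup>2))"
proof -
  let ?S = "\<lambda>x. (overlap N \<xi> x)\<^sup>2"
  let ?t = "\<beta> * sqrt (real N / real M)"
  have Z: "(\<Sum>x\<in>configs N. cavity_weight \<beta> B N M \<xi> x) \<le> partition_fun \<beta> B N M \<xi>"
    unfolding partition_fun_def boltzmann_weight_cavity[OF assms(2,3)]
  proof (rule sum_mono)
    fix x
    have "1 * cavity_weight \<beta> B N M \<xi> x \<le> exp (?t * ?S x) * cavity_weight \<beta> B N M \<xi> x"
      using assms(1) by (intro mult_right_mono order_less_imp_le[OF cavity_weight_pos]) simp
    then show "cavity_weight \<beta> B N M \<xi> x \<le> exp (?t * ?S x) * cavity_weight \<beta> B N M \<xi> x"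
      by simp
  qed
  \<comment> \<open>The numerator is treated exactly: the factor of the first pattern merges with
    the observable. Only the denominator is estimated.\<close>
  have "(\<integral>x. exp (c * ?S x) \<partial>gibbs \<beta> B N M \<xi>)
      = (\<Sum>x\<in>configs N. cavity_weight \<beta> B N M \<xi> x * exp ((?t + c) * ?S x)) / partition_fun \<beta> B N M \<xi>"
    unfolding integral_gibbs boltzmann_weight_cavity[OF assms(2,3)] distrib_right exp_add
    by (simp only: mult_ac)
  also have "\<dots> \<le> (\<Sum>x\<in>configs N. cavity_weight \<beta> B N M \<xi> x * exp ((?t + c) * ?S x)) /
      (\<Sum>x\<in>configs N. cavity_weight \<beta> B N M \<xi> x)"
    using Z by (intro divide_left_mono mult_pos_pos partition_fun_pos cavity_sum_pos sum_nonneg)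
      (simp_all add: cavity_weight_pos order_less_imp_le)
  finally show ?thesis
    by (simp add: cavity_prob_def sum_divide_distrib)
qed

section \<open>Averaging over Bernoulli patterns\<close>

lemma configs_square:
  assumes "x \<in> configs N" "i \<in> {1..N}"
  shows "(x i)\<^sup>2 = 1"
proof -
  have "x i \<in> {-1, 1}"
    using assms unfolding configs_def by (rule PiE_mem)
  then show ?thesis by auto
qed

lemma bernoulli_patterns_measurable:
  assumes "bernoulli_patterns P N M \<xi>" "k \<in> {1..M}" "i \<in> {1..N}"
  shows "\<xi> k i \<in> borel_measurable P"
proof -
  interpret prob_space P
    using assms(1) by (simp add: bernoulli_patterns_def)
  have "indep_vars (\<lambda>_. borel) (\<lambda>(k, i). \<xi> k i) ({1..M} \<times> {1..N})"
    using assms(1) by (simp add: bernoulli_patterns_def)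
  then have "random_variable borel (case (k, i) of (k, i) \<Rightarrow> \<xi> k i)"
    unfolding indep_vars_def using assms(2,3) by blast
  then show ?thesis by simp
qed

text \<open>For fixed \<open>x\<close>, the overlap is a sum of independent fair signs with
  coefficients \<open>x i / sqrt N\<close>, whose squares add up to 1. The linearisation bound
  therefore applies with variance proxy 1.\<close>

lemma bernoulli_patterns_exp_overlap:
  assumes bern: "bernoulli_patterns P N M \<xi>" and "N \<ge> 1" "M \<ge> 1"
    and x: "x \<in> configs N" and t: "0 \<le> t" "t < 1 / 2"
  defines "E \<equiv> \<lambda>\<omega>. exp (t * (overlap N (\<lambda>k i. \<xi> k i \<omega>) x)\<^sup>2)"
  shows "integrable P E" and "(\<integral>\<omega>. E \<omega> \<partial>P) \<le> 1 / sqrt (1 - 2 * t)"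
proof -
  interpret prob_space P
    using bern by (simp add: bernoulli_patterns_def)
  let ?S = "\<lambda>\<omega>. overlap N (\<lambda>k i. \<xi> k i \<omega>) x"
  have rv [measurable]: "\<xi> 1 i \<in> borel_measurable P" if "i \<in> {1..N}" for i
    using bernoulli_patterns_measurable[OF bern] that \<open>M \<ge> 1\<close> by auto
  have half: "prob {\<omega> \<in> space P. \<xi> 1 i \<omega> = 1} = 1 / 2" "prob {\<omega> \<in> space P. \<xi> 1 i \<omega> = - 1} = 1 / 2"
    if "i \<in> {1..N}" for i
    using bern that \<open>M \<ge> 1\<close> by (auto simp: bernoulli_patterns_def)
  have S [measurable]: "?S \<in> borel_measurable P"
    unfolding overlap_def dotp_def by (intro borel_measurable_divide borel_measurable_sum
        borel_measurable_times rv borel_measurable_const)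
  have "indep_vars (\<lambda>_. borel) (\<lambda>(k, i). \<xi> k i) ({1..M} \<times> {1..N})"
    using bern by (simp add: bernoulli_patterns_def)
  then have ind: "indep_vars (\<lambda>_. borel) (\<lambda>(k, i). \<xi> k i) ({1} \<times> {1..N})"
    by (rule indep_vars_subset) (use \<open>M \<ge> 1\<close> in auto)
  \<comment> \<open>The independent family is indexed by pairs, so the sum over sites is rewritten
    as a sum over the block of the first pattern.\<close>
  have sum_J: "(\<Sum>p\<in>{1} \<times> {1..N}. f p) = (\<Sum>i = 1..N. f (1, i))" for f :: "nat \<times> nat \<Rightarrow> real"
    using sum.cartesian_product[of "\<lambda>k i. f (k, i)" "{1..N}" "{1}"] by simp
  have bound: "(\<integral>\<^sup>+ \<omega>. ennreal (E \<omega>) \<partial>P) \<le> ennreal (1 / sqrt (1 - 2 * t))"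
    unfolding E_def
  proof (rule nn_integral_exp_square_le[OF S _ t])
    fix s
    let ?a = "\<lambda>(k :: nat, i). s * x i / sqrt (real N)"
    have "(\<integral>\<^sup>+ \<omega>. ennreal (exp (s * ?S \<omega>)) \<partial>P) = (\<integral>\<^sup>+ \<omega>. ennreal (exp (\<Sum>p\<in>{1} \<times> {1..N}. ?a p * (case p of (k, i) \<Rightarrow> \<xi> k i) \<omega>)) \<partial>P)"
      unfolding sum_J by (simp add: overlap_def dotp_def sum_divide_distrib sum_distrib_left mult_ac)
    also have "\<dots> \<le> ennreal (exp ((\<Sum>p\<in>{1} \<times> {1..N}. (?a p)\<^sup>2) / 2))"
    proof (rule nn_integral_exp_sum_le)
      fix p assume p: "p \<in> {1 :: nat} \<times> {1..N}"
      then obtain i where i: "p = (1, i)" "i \<in> {1..N}" by auto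
      show "AE \<omega> in P. \<bar>(case p of (k, i) \<Rightarrow> \<xi> k i) \<omega>\<bar> \<le> 1"
        using fair_sign_AE[OF rv half, OF i(2) i(2) i(2)] unfolding i(1) by eventually_elim auto
      show "expectation (case p of (k, i) \<Rightarrow> \<xi> k i) = 0"
        using fair_sign_expectation[OF rv half, OF i(2) i(2) i(2)] by (simp add: i(1))
    qed (use ind in auto)
    also have "(\<Sum>p\<in>{1} \<times> {1..N}. (?a p)\<^sup>2) = s\<^sup>2"
      unfolding sum_J using configs_square[OF x] \<open>N \<ge> 1\<close> by (simp add: power_divide power_mult_distrib)
    finally show "(\<integral>\<^sup>+ \<omega>. ennreal (exp (s * ?S \<omega>)) \<partial>P) \<le> ennreal (exp (s\<^sup>2 / 2))" .
  qed
  \<comment> \<open>The finite nonnegative integral gives integrability, which then allows the same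
    bound to be read off for the Bochner integral.\<close>
  show int: "integrable P E"
  proof (rule integrableI_nonneg)
    show "(\<integral>\<^sup>+ \<omega>. ennreal (E \<omega>) \<partial>P) < \<infinity>"
      using bound by (rule le_less_trans) simp
  qed (auto simp: E_def)
  have "(\<integral>\<^sup>+ \<omega>. ennreal (E \<omega>) \<partial>P) = ennreal (\<integral>\<omega>. E \<omega> \<partial>P)"
    using int by (intro nn_integral_eq_integral) (auto simp: E_def)
  then show "(\<integral>\<omega>. E \<omega> \<partial>P) \<le> 1 / sqrt (1 - 2 * t)"
    using bound t by (simp only: ennreal_le_iff) simp
qed

text \<open>The two variables are measurable functions of disjoint blocks of an independent family:
  patterns \<open>2..M\<close> and pattern 1.\<close>

lemma bernoulli_patterns_indep_cavity:
  assumes bern: "bernoulli_patterns P N M \<xi>" and "M \<ge> 1"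
  shows "prob_space.indep_var P borel (\<lambda>\<omega>. cavity_prob \<beta> B N M (\<lambda>k i. \<xi> k i \<omega>) x)
    borel (\<lambda>\<omega>. exp (t * (overlap N (\<lambda>k i. \<xi> k i \<omega>) x)\<^sup>2))"
proof -
  interpret prob_space P
    using bern by (simp add: bernoulli_patterns_def)
  let ?X = "\<lambda>\<omega> p. (case p of (k, i) \<Rightarrow> \<xi> k i) \<omega>"
  let ?I = "{2..M} \<times> {1..N}" and ?J = "{1} \<times> {1..N}"
  define F where "F r = cavity_prob \<beta> B N M (\<lambda>k i. r (k, i)) x" for r
  define G where "G r = exp (t * (overlap N (\<lambda>k i. r (k, i)) x)\<^sup>2)" for r
  have ind: "indep_vars (\<lambda>_. borel) (\<lambda>(k, i). \<xi> k i) ({1..M} \<times> {1..N})"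
    using bern by (simp add: bernoulli_patterns_def)
  have F [measurable]: "F \<in> borel_measurable (PiM ?I (\<lambda>_. borel))"
    unfolding F_def cavity_prob_def cavity_weight_def dotp_def by measurable
  have G [measurable]: "G \<in> borel_measurable (PiM ?J (\<lambda>_. borel))"
    unfolding G_def overlap_def dotp_def by measurable
  have "indep_var borel (F \<circ> (\<lambda>\<omega>. restrict (?X \<omega>) ?I)) borel (G \<circ> (\<lambda>\<omega>. restrict (?X \<omega>) ?J))"
    by (rule indep_var_compose[OF indep_var_restrict[OF ind] F G]) (use \<open>M \<ge> 1\<close> in auto)
  \<comment> \<open>Restriction makes entries outside the block \<open>undefined\<close>, but
    \<open>F\<close> reads none of them.\<close>
  moreover have "F \<circ> (\<lambda>\<omega>. restrict (?X \<omega>) ?I) = (\<lambda>\<omega>. cavity_prob \<beta> B N M (\<lambda>k i. \<xi> k i \<omega>) x)"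
    by (intro ext) (auto simp: F_def intro!: cavity_prob_cong)
  moreover have "G \<circ> (\<lambda>\<omega>. restrict (?X \<omega>) ?J) = (\<lambda>\<omega>. exp (t * (overlap N (\<lambda>k i. \<xi> k i \<omega>) x)\<^sup>2))"
    unfolding G_def by (auto simp: overlap_def dotp_def)
  ultimately show ?thesis by simp
qed

text \<open>Averaging the cavity bound factorises each summand by independence. The overlap factor
  has the same bound for every \<open>x\<close>, and the cavity probabilities sum to 1, so the
  \<open>2 ^ N\<close> configurations cost nothing. The parameter \<open>t\<close> caps the
  exponent, so that the final bound does not depend on \<open>N\<close> and
  \<open>M\<close>.\<close>

lemma bernoulli_patterns_gibbs_bound:
  fixes \<beta> B c t :: real
  assumes bern: "bernoulli_patterns P N M \<xi>" and "N \<ge> 1" "M \<ge> 1" "\<beta> \<ge> 0"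
    and t: "0 \<le> \<beta> * sqrt (real N / real M) + c" "\<beta> * sqrt (real N / real M) + c \<le> t" "t < 1 / 2"
  defines "A \<equiv> \<lambda>\<omega>. \<integral>x. exp (c * (overlap N (\<lambda>k i. \<xi> k i \<omega>) x)\<^sup>2) \<partial>gibbs \<beta> B N M (\<lambda>k i. \<xi> k i \<omega>)"
  shows "integrable P A" and "(\<integral>\<omega>. A \<omega> \<partial>P) \<le> 1 / sqrt (1 - 2 * t)"
proof -
  interpret prob_space P
    using bern by (simp add: bernoulli_patterns_def)
  let ?\<xi> = "\<lambda>\<omega> k i. \<xi> k i \<omega>"
  let ?s = "\<beta> * sqrt (real N / real M) + c"
  let ?p = "\<lambda>x \<omega>. cavity_prob \<beta> B N M (?\<xi> \<omega>) x"
  let ?E = "\<lambda>x \<omega>. exp (?s * (overlap N (?\<xi> \<omega>) x)\<^sup>2)"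
  define C where "C = (\<lambda>\<omega>. \<Sum>x\<in>configs N. ?p x \<omega> * ?E x \<omega>)"
  have rv: "\<xi> k i \<in> borel_measurable P" if "k \<in> {1..M}" "i \<in> {1..N}" for k i
    using bernoulli_patterns_measurable[OF bern that] .
  have dot: "(\<lambda>\<omega>. dotp N x (?\<xi> \<omega> k)) \<in> borel_measurable P" if "k \<in> {1..M}" for k x
    unfolding dotp_def using rv that by (intro borel_measurable_sum borel_measurable_times) auto
  have [measurable]: "(\<lambda>\<omega>. dotp N x (?\<xi> \<omega> 1)) \<in> borel_measurable P"
      "(\<lambda>\<omega>. \<Sum>k = 1..M. (dotp N x (?\<xi> \<omega> k))\<^sup>2) \<in> borel_measurable P" for x
    using \<open>M \<ge> 1\<close> by (intro borel_measurable_sum borel_measurable_power dot; simp)+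
  have A_meas: "A \<in> borel_measurable P"
    unfolding A_def integral_gibbs boltzmann_weight_def partition_fun_def hopfield_H_def overlap_def
    by measurable
  have ind: "indep_var borel (?p x) borel (?E x)" for x
    using bernoulli_patterns_indep_cavity[OF bern \<open>M \<ge> 1\<close>] .
  have p_int: "integrable P (?p x)" if "x \<in> configs N" for x
    using indep_var_rv1[OF ind[of x]] that
    by (intro integrable_const_bound[of _ 1]) (auto simp: cavity_prob_nonneg cavity_prob_le_1)
  have s: "?s < 1 / 2" using t by simp
  note E = bernoulli_patterns_exp_overlap[OF bern \<open>N \<ge> 1\<close> \<open>M \<ge> 1\<close> _ t(1) s]
  have pE_int: "integrable P (\<lambda>\<omega>. ?p x \<omega> * ?E x \<omega>)" if "x \<in> configs N" for x
    by (rule indep_var_integrable[OF ind p_int[OF that] E(1)[OF that]])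
  have C_int: "integrable P C"
    unfolding C_def using pE_int by (rule Bochner_Integration.integrable_sum)
  have A_nonneg: "0 \<le> A \<omega>" for \<omega>
    unfolding A_def by (intro integral_nonneg_AE) simp
  have A_le: "A \<omega> \<le> C \<omega>" for \<omega>
    unfolding A_def C_def by (rule gibbs_integral_le_cavity[OF \<open>\<beta> \<ge> 0\<close> \<open>N \<ge> 1\<close> \<open>M \<ge> 1\<close>])
  \<comment> \<open>\<open>A\<close> is nonnegative and dominated by the integrable cavity majorant
    \<open>C\<close>.\<close>
  show A_int: "integrable P A"
    using A_nonneg order_trans[OF A_le abs_ge_self]
    by (intro Bochner_Integration.integrable_bound[OF C_int A_meas]) auto
  have sum_p: "(\<integral>\<omega>. (\<Sum>x\<in>configs N. ?p x \<omega>) \<partial>P) = (\<Sum>x\<in>configs N. \<integral>\<omega>. ?p x \<omega> \<partial>P)"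
    using p_int by (rule Bochner_Integration.integral_sum)
  have "(\<integral>\<omega>. A \<omega> \<partial>P) \<le> (\<integral>\<omega>. C \<omega> \<partial>P)"
    using A_int C_int A_le by (rule integral_mono)
  also have "\<dots> = (\<Sum>x\<in>configs N. \<integral>\<omega>. ?p x \<omega> * ?E x \<omega> \<partial>P)"
    unfolding C_def using pE_int by (rule Bochner_Integration.integral_sum)
  also have "\<dots> = (\<Sum>x\<in>configs N. (\<integral>\<omega>. ?p x \<omega> \<partial>P) * (\<integral>\<omega>. ?E x \<omega> \<partial>P))"
    by (rule sum.cong[OF refl]) (rule indep_var_lebesgue_integral[OF ind p_int E(1)])
  also have "\<dots> \<le> (\<Sum>x\<in>configs N. (\<integral>\<omega>. ?p x \<omega> \<partial>P) * (1 / sqrt (1 - 2 * ?s)))"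
    by (intro sum_mono mult_left_mono E(2) integral_nonneg_AE) (auto simp: cavity_prob_nonneg)
  \<comment> \<open>The common constant comes out, and what remains is the expectation of the total
    cavity mass, which is identically 1.\<close>
  also have "\<dots> = (\<integral>\<omega>. (\<Sum>x\<in>configs N. ?p x \<omega>) \<partial>P) * (1 / sqrt (1 - 2 * ?s))"
    unfolding sum_p by (rule sum_distrib_right[symmetric])
  also have "\<dots> = 1 / sqrt (1 - 2 * ?s)"
    by (simp add: sum_cavity_prob prob_space)
  also have "\<dots> \<le> 1 / sqrt (1 - 2 * t)"
    using t by (intro divide_left_mono) auto
  finally show "(\<integral>\<omega>. A \<omega> \<partial>P) \<le> 1 / sqrt (1 - 2 * t)" .
qed

text \<open>Integrability stands beside the bound because the Bochner integral of a nonintegrable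
  function is 0 by convention; the inequality alone would not express finiteness.\<close>

theorem theorem3:
  fixes \<beta> B \<alpha>\<^sub>0 :: real
  assumes "\<beta> > 0" and "\<alpha>\<^sub>0 > 4 * \<beta>\<^sup>2"
  shows "\<exists>c > 0. \<exists>K :: real. \<forall>N \<ge> 1. \<forall>M \<ge> 1. real M / real N \<ge> \<alpha>\<^sub>0 \<longrightarrow>
    (\<forall>(P :: 'w measure) \<xi>. bernoulli_patterns P N M \<xi> \<longrightarrow>
      integrable P (\<lambda>\<omega>. \<integral>x. exp (c * (overlap N (\<lambda>k i. \<xi> k i \<omega>) x)\<^sup>2)
        \<partial>gibbs \<beta> B N M (\<lambda>k i. \<xi> k i \<omega>)) \<and>
      (\<integral>\<omega>. (\<integral>x. exp (c * (overlap N (\<lambda>k i. \<xi> k i \<omega>) x)\<^sup>2)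
        \<partial>gibbs \<beta> B N M (\<lambda>k i. \<xi> k i \<omega>)) \<partial>P) \<le> K)"
proof -
  \<comment> \<open>\<open>b\<close> is the largest value of \<open>\<beta> * sqrt (N / M)\<close>
    allowed by \<open>M / N \<ge> \<alpha>\<^sub>0\<close>; the assumption
    \<open>\<alpha>\<^sub>0 > 4 * \<beta>\<^sup>2\<close> says exactly that it is below
    \<open>1 / 2\<close>.\<close>
  define b where "b = \<beta> / sqrt \<alpha>\<^sub>0"
  have "\<alpha>\<^sub>0 > 0"
    using assms(2) by (rule le_less_trans[rotated]) simp
  have "2 * \<beta> < sqrt \<alpha>\<^sub>0"
    using assms by (intro real_less_rsqrt) (simp add: power_mult_distrib)
  then have b: "b < 1 / 2"
    using \<open>\<alpha>\<^sub>0 > 0\<close> by (simp add: b_def field_simps)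
  \<comment> \<open>Half of the gap between \<open>b\<close> and \<open>1 / 2\<close>, so that
    \<open>b + c\<close> is still below the threshold.\<close>
  define c where "c = (1 / 2 - b) / 2"
  have c: "c > 0" "b + c < 1 / 2"
    using b by (simp_all add: c_def field_simps)
  have le_b: "\<beta> * sqrt (real N / real M) \<le> b" if "N \<ge> 1" "M \<ge> 1" "real M / real N \<ge> \<alpha>\<^sub>0" for N M :: nat
  proof -
    have "real N / real M \<le> 1 / \<alpha>\<^sub>0"
      using that \<open>\<alpha>\<^sub>0 > 0\<close> by (simp add: field_simps)
    then have "sqrt (real N / real M) \<le> 1 / sqrt \<alpha>\<^sub>0"
      by (metis real_sqrt_divide real_sqrt_le_iff real_sqrt_one)
    then show ?thesis
      using mult_left_mono[of "sqrt (real N / real M)" "1 / sqrt \<alpha>\<^sub>0" \<beta>] \<open>\<beta> > 0\<close> by (simp add: b_def)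
  qed
  show ?thesis
  \<comment> \<open>The witness for \<open>K\<close> is the averaged bound at
    \<open>t = b + c\<close>, the worst exponent over all admissible \<open>N\<close> and
    \<open>M\<close>.\<close>
  proof (rule exI[of _ c], rule conjI[OF c(1)], rule exI[of _ "1 / sqrt (1 - 2 * (b + c))"], intro allI impI conjI)
    fix N M :: nat and P :: "'w measure" and \<xi>
    assume NM: "N \<ge> 1" "M \<ge> 1" "real M / real N \<ge> \<alpha>\<^sub>0" and bern: "bernoulli_patterns P N M \<xi>"
    have "0 \<le> \<beta> * sqrt (real N / real M) + c" "\<beta> * sqrt (real N / real M) + c \<le> b + c"
      using \<open>\<beta> > 0\<close> c(1) le_b[OF NM] by simp_all
    note bound = bernoulli_patterns_gibbs_bound[OF bern NM(1,2) less_imp_le[OF \<open>\<beta> > 0\<close>] this c(2)]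
    show "integrable P (\<lambda>\<omega>. \<integral>x. exp (c * (overlap N (\<lambda>k i. \<xi> k i \<omega>) x)\<^sup>2)
        \<partial>gibbs \<beta> B N M (\<lambda>k i. \<xi> k i \<omega>))"
      by (rule bound(1))
    show "(\<integral>\<omega>. (\<integral>x. exp (c * (overlap N (\<lambda>k i. \<xi> k i \<omega>) x)\<^sup>2)
        \<partial>gibbs \<beta> B N M (\<lambda>k i. \<xi> k i \<omega>)) \<partial>P) \<le> 1 / sqrt (1 - 2 * (b + c))"
      by (rule bound(2))
  qed
qed

end
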